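(* Let $G=(V,E)$ be a graph with finitely many vertices and edges, let $\mathscr{H}$ be the set of all subgraphs of $G$, and let $w:\mathscr{H}\to\mathbb{R}_+$ be a weight function. Define $\overline{w}:\mathscr{H}\to\mathbb{R}_+$ by $$\overline{w}(H):=\min\{\,w(H') \mid H'\in\mathscr{H},\ H\subseteq H'\,\}\qquad (H\in\mathscr{H}).$$ Then $\overline{w}$ is the largest monotonically increasing minorant of $w$; that is, $\overline{w}$ is monotone increasing, $\overline{w}(H)\le w(H)$ for all $H\in\mathscr{H}$, and every monotone increasing function $v:\mathscr{H}\to\mathbb{R}_+$ with $v(H)\le w(H)$ for all $H\in\mathscr{H}$ satisfies $v(H)\le\overline{w}(H)$ for all $H\in\mathscr{H}$.
   Context: $\mathbb{R}_+$ denotes the set of non-negative real numbers. For subgraphs, $H\subseteq H'$ means that $H$ is a subgraph of $H'$. A weighted graph $G(V,E,w)$ is a graph $G=(V,E)$ together with a function $w:\mathscr{H}\to\mathbb{R}_+$ on the set $\mathscr{H}$ of all subgraphs of $G$. The function $w$ (equivalently, the weighted graph) is called monotone (increasing) if $w(H_1)\le w(H_2)$ for all $H_1,H_2\in\mathscr{H}$ with $H_1\subset H_2$. A minorant of $w$ with a property $P$ is a function $v:\mathscr{H}\to\mathbb{R}_+$ having property $P$ with $v(H)\le w(H)$ for all $H\in\mathscr{H}$; the largest such minorant is the one that is pointwise greater than or equal to all others. *)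

theory Defs
  imports Complex_Main "HOL-Library.FuncSet"
begin

text \<open>
  Undirected graphs, with loops and parallel edges allowed: \<open>ends e\<close> is the set of the one or two
  end vertices of the edge \<open>e\<close>.  Simple graphs are the case where edges are two-element sets of
  vertices and \<open>ends\<close> is the identity.
\<close>

record ('v, 'e) graph =
  vertices :: "'v set"
  edges :: "'e set"
  ends :: "'e \<Rightarrow> 'v set"

definition wf_graph :: "('v, 'e) graph \<Rightarrow> bool" where
  "wf_graph G \<longleftrightarrow> (\<forall>e\<in>edges G. ends G e \<subseteq> vertices G \<and> card (ends G e) \<in> {1, 2})"

definition finite_graph :: "('v, 'e) graph \<Rightarrow> bool" where
  "finite_graph G \<longleftrightarrow> wf_graph G \<and> finite (vertices G) \<and> finite (edges G)"

text \<open>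
  The incidence maps are required to agree as total functions, not just on the edges of \<open>H\<close>, so that
  a subgraph is determined by its vertices and edges.
\<close>

definition subgraph :: "('v, 'e) graph \<Rightarrow> ('v, 'e) graph \<Rightarrow> bool" (infix "\<sqsubseteq>" 50) where
  "H \<sqsubseteq> H' \<longleftrightarrow> wf_graph H \<and> wf_graph H' \<and>
     vertices H \<subseteq> vertices H' \<and> edges H \<subseteq> edges H' \<and> ends H = ends H'"

definition subgraphs :: "('v, 'e) graph \<Rightarrow> ('v, 'e) graph set" where
  "subgraphs G = {H. H \<sqsubseteq> G}"

text \<open>Only the values of a weight function on \<open>subgraphs G\<close> are meaningful.\<close>

definition weight_functions :: "('v, 'e) graph \<Rightarrow> (('v, 'e) graph \<Rightarrow> real) set" where
  "weight_functions G = subgraphs G \<rightarrow> {0..}"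

definition increasing :: "('v, 'e) graph \<Rightarrow> (('v, 'e) graph \<Rightarrow> real) \<Rightarrow> bool" where
  "increasing G w \<longleftrightarrow> monotone_on (subgraphs G) (\<sqsubseteq>) (\<le>) w"

definition increasing_minorant ::
    "('v, 'e) graph \<Rightarrow> (('v, 'e) graph \<Rightarrow> real) \<Rightarrow> (('v, 'e) graph \<Rightarrow> real) \<Rightarrow> bool" where
  "increasing_minorant G w v \<longleftrightarrow>
     v \<in> weight_functions G \<and> increasing G v \<and> (\<forall>H\<in>subgraphs G. v H \<le> w H)"

definition monotone_hull ::
    "('v, 'e) graph \<Rightarrow> (('v, 'e) graph \<Rightarrow> real) \<Rightarrow> ('v, 'e) graph \<Rightarrow> real" where
  "monotone_hull G w H = Min {w H' | H'. H' \<in> subgraphs G \<and> H \<sqsubseteq> H'}"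

end

theory Submission
  imports Defs
begin

text \<open>A finite graph has finitely many subgraphs (\<open>finite_subgraphs\<close>), so the
  minimum over the subgraphs above \<open>H\<close> is a lower bound for their weights
  (\<open>monotone_hull_le\<close>) and is the weight of one of them
  (\<open>monotone_hull_attained\<close>). Enlarging \<open>H\<close> leaves fewer competitors, so
  the minimum can only grow; \<open>H\<close> competes with itself, so the minimum is at most
  \<open>w H\<close>. If \<open>v\<close> is an increasing minorant and \<open>H'\<close> a
  minimiser above \<open>H\<close>, then \<open>v H\<close> \<le> \<open>v H'\<close> \<le>
  \<open>w H'\<close>, which is the minimum.\<close>

text \<open>Only well-formed graphs are subgraphs of themselves; the premise serves to supply
  well-formedness of \<open>H\<close>.\<close>

lemma subgraph_refl: "H \<sqsubseteq> H' \<Longrightarrow> H \<sqsubseteq> H"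
  by (auto simp: subgraph_def)

lemma subgraph_trans: "H \<sqsubseteq> H' \<Longrightarrow> H' \<sqsubseteq> H'' \<Longrightarrow> H \<sqsubseteq> H''"
  by (auto simp: subgraph_def)

text \<open>All subgraphs share the incidence map \<open>ends G\<close>, so each is determined by a
  pair from the product of two finite power sets.\<close>

lemma finite_subgraphs:
  fixes G :: "('v, 'e) graph"
  assumes "finite_graph G"
  shows "finite (subgraphs G)"
proof (rule finite_subset)
  show "subgraphs G \<subseteq> (\<lambda>(V, E). \<lparr>vertices = V, edges = E, ends = ends G\<rparr>) `
    (Pow (vertices G) \<times> Pow (edges G))"
  proof
    fix H assume "H \<in> subgraphs G"
    then show "H \<in> (\<lambda>(V, E). \<lparr>vertices = V, edges = E, ends = ends G\<rparr>) `
      (Pow (vertices G) \<times> Pow (edges G))"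
      by (cases H) (auto simp: subgraphs_def subgraph_def image_iff)
  qed
qed (use assms in \<open>simp add: finite_graph_def\<close>)

lemma finite_weights_above:
  assumes "finite_graph G"
  shows "finite {w H' | H'. H' \<in> subgraphs G \<and> H \<sqsubseteq> H'}"
  using finite_subgraphs[OF assms] by (intro finite_image_set finite_Collect_conjI) auto

lemma monotone_hull_le:
  assumes "finite_graph G" "H' \<in> subgraphs G" "H \<sqsubseteq> H'"
  shows "monotone_hull G w H \<le> w H'"
  unfolding monotone_hull_def using assms finite_weights_above by (intro Min_le) auto

lemma monotone_hull_attained:
  assumes "finite_graph G" "H \<in> subgraphs G"
  obtains H' where "H' \<in> subgraphs G" "H \<sqsubseteq> H'" "monotone_hull G w H = w H'"
proof -
  \<comment> \<open>This makes the set of competing weights nonempty, as \<open>Min_in\<close>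
    demands.\<close>
  have "H \<sqsubseteq> H"
    using assms(2) by (auto simp: subgraphs_def intro: subgraph_refl)
  then have "monotone_hull G w H \<in> {w H' | H'. H' \<in> subgraphs G \<and> H \<sqsubseteq> H'}"
    unfolding monotone_hull_def using assms finite_weights_above by (intro Min_in) auto
  then show thesis
    using that by auto
qed

theorem proposition1p1:
  fixes G :: "('v, 'e) graph" and w :: "('v, 'e) graph \<Rightarrow> real"
  assumes "finite_graph G"
    and "w \<in> weight_functions G"
  shows "increasing_minorant G w (monotone_hull G w) \<and>
    (\<forall>v. increasing_minorant G w v \<longrightarrow> (\<forall>H\<in>subgraphs G. v H \<le> monotone_hull G w H))"
proof (intro conjI allI impI ballI)
  have "monotone_hull G w H \<ge> 0" if H: "H \<in> subgraphs G" for H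
  proof -
    obtain H' where "H' \<in> subgraphs G" "monotone_hull G w H = w H'"
      using monotone_hull_attained[OF assms(1) H] by metis
    then show ?thesis
      using assms(2) by (auto simp: weight_functions_def)
  qed
  moreover have "monotone_hull G w H1 \<le> monotone_hull G w H2"
    if H2: "H2 \<in> subgraphs G" "H1 \<sqsubseteq> H2" for H1 H2
  proof -
    \<comment> \<open>By transitivity a minimiser above \<open>H2\<close> also competes in the
      minimum for \<open>H1\<close>.\<close>
    obtain H' where H': "H' \<in> subgraphs G" "H2 \<sqsubseteq> H'" "monotone_hull G w H2 = w H'"
      using monotone_hull_attained[OF assms(1) H2(1)] .
    then show ?thesis
      using monotone_hull_le[OF assms(1) H'(1) subgraph_trans[OF H2(2) H'(2)]] by simp
  qed
  moreover have "monotone_hull G w H \<le> w H" if "H \<in> subgraphs G" for H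
    using that by (intro monotone_hull_le assms(1)) (auto simp: subgraphs_def intro: subgraph_refl)
  ultimately show "increasing_minorant G w (monotone_hull G w)"
    by (auto simp: increasing_minorant_def weight_functions_def increasing_def monotone_on_def)
next
  fix v H assume v: "increasing_minorant G w v" and H: "H \<in> subgraphs G"
  obtain H' where H': "H' \<in> subgraphs G" "H \<sqsubseteq> H'" "monotone_hull G w H = w H'"
    using monotone_hull_attained[OF assms(1) H] .
  \<comment> \<open>Monotonicity of \<open>v\<close> moves the comparison from \<open>H\<close> to
    the minimiser \<open>H'\<close>, where \<open>w\<close> equals the hull at
    \<open>H\<close>.\<close>
  have "v H \<le> v H'"
    using v H H' by (auto simp: increasing_minorant_def increasing_def monotone_on_def)
  also have "\<dots> \<le> w H'"
    using v H' by (simp add: increasing_minorant_def)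
  finally show "v H \<le> monotone_hull G w H"
    using H' by simp
qed

end
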